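(* Suppose the algorithm used by \textsc{NaiveAllocation} to compute the tour of each agent has approximation factor $\alpha$. Then \textsc{NaiveAllocation} is an $\alpha k$-approximation algorithm for the Heterogeneous Task Allocation Problem (HTAP), where $k$ is the number of agents. That is, for every instance of HTAP with $k$ agents, it efficiently returns a set of tours, one per agent, that forms a feasible solution and whose maximum cost is at most $\alpha k$ times the optimal value of the instance.
   Context: **The problem (HTAP).** There are $k$ agents $A_1,\dots,A_k$, partitioned into $m$ types by a function $f:\{1,\dots,k\}\to\{1,\dots,m\}$; $m_i\ge 1$ is the number of agents of type $i$, so $\sum_{i=1}^m m_i=k$. A finite task set $T$ is partitioned as $T=T_0\cup T_1\cup\dots\cup T_m$, where $T_0$ is the set of generic tasks (which any agent can perform) and, for $1\le i\le m$, $T_i$ is the set of type-specific tasks that only agents of type $i$ can perform. All agents start at a node $v_s$. On the vertex set $V=T\cup\{v_s\}$ consider the complete undirected graph $G$ with edge weights (distances) $d(u,v)\ge 0$ satisfying the triangle inequality. A tour on $V'\subseteq V$ is a closed path starting and ending at $v_s$ that visits all nodes of $V'$; its cost is the sum of its edge weights. $C^*(V')$ is the minimum cost of a tour on $V'$ (with $C^*(\emptyset)=0$). HTAP asks for $$\min_{S_1,\dots,S_k\subseteq T}\ \max_{1\le j\le k} C^*(S_j)\quad\text{subject to}\quad \bigcup_{j=1}^k S_j=T,\quad S_j=V_j\cup R_j,\ V_j\subseteq T_{f(j)},\ R_j\subseteq T_0\ \ (1\le j\le k).$$ A feasible solution consists of such an allocation (the same task may be allocated to several agents) together with a tour on $S_j$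 for each agent $A_j$; its value is the maximum cost of these tours. An $\alpha$-approximation algorithm is an algorithm that efficiently (in polynomial time) finds, for every instance, a feasible solution whose value is at most $\alpha$ times the optimum. **Algorithm NaiveAllocation.** (1) Allocate to each agent $A_j$ all type-specific tasks of its type, $T_{f(j)}$. (2) Allocate all generic tasks $T_0$ to agent $A_1$. (3) For each agent, compute a tour (starting and ending at $v_s$) on the set of tasks allocated to it, using an approximation algorithm for the single-agent tour problem; approximation factor $\alpha$ means that, in polynomial time, on every set $V'$ it returns a tour of cost at most $\alpha\, C^*(V')$. (4) Return the tours. *)

theory Defs
  imports Complex_Main "HOL-Computational_Algebra.Polynomial" "HOL-Library.Log_Nat"
begin

record network =
  start :: nat
  verts :: "nat set"
  dist :: "nat \<Rightarrow> nat \<Rightarrow> real"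

text \<open>
  The edges of the complete graph join distinct vertices, so \<open>dist G u u\<close> is unconstrained.
\<close>

definition metric_network :: "network \<Rightarrow> bool" where
  "metric_network G \<longleftrightarrow>
     finite (verts G) \<and> start G \<in> verts G \<and>
     (\<forall>u\<in>verts G. \<forall>v\<in>verts G. u \<noteq> v \<longrightarrow> dist G u v \<ge> 0 \<and> dist G u v = dist G v u) \<and>
     (\<forall>u\<in>verts G. \<forall>v\<in>verts G. \<forall>w\<in>verts G.
        u \<noteq> v \<longrightarrow> v \<noteq> w \<longrightarrow> u \<noteq> w \<longrightarrow> dist G u w \<le> dist G u v + dist G v w)"

text \<open>
  A tour is a closed walk along edges of the complete graph. It may revisit vertices and may pass
  through vertices outside \<open>V'\<close>. The walk \<open>[start G]\<close> without edges is a tour on the empty set.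
\<close>

definition is_tour :: "network \<Rightarrow> nat set \<Rightarrow> nat list \<Rightarrow> bool" where
  "is_tour G V' w \<longleftrightarrow>
     w \<noteq> [] \<and> hd w = start G \<and> last w = start G \<and> set w \<subseteq> verts G \<and>
     successively (\<noteq>) w \<and> V' \<subseteq> set w"

definition walk_cost :: "network \<Rightarrow> nat list \<Rightarrow> real" where
  "walk_cost G w = sum_list (map2 (dist G) w (tl w))"

definition opt_tour_cost :: "network \<Rightarrow> nat set \<Rightarrow> real" where
  "opt_tour_cost G V' = Inf {walk_cost G w |w. is_tour G V' w}"

text \<open>The infimum is attained, so \<open>opt_tour_cost G V'\<close> is the minimum cost of a tour on \<open>V'\<close>.\<close>

lemma walk_cost_append: "walk_cost G (a @ p # c) = walk_cost G (a @ [p]) + walk_cost G (p # c)"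
proof (induction a)
  case Nil
  show ?case by (simp add: walk_cost_def)
next
  case (Cons x a)
  then show ?case by (cases a) (simp_all add: walk_cost_def)
qed

lemma tour_shortcut:
  assumes G: "metric_network G" and w: "is_tour G V' w" and nd: "\<not> distinct (butlast w)"
  shows "\<exists>w'. is_tour G V' w' \<and> walk_cost G w' \<le> walk_cost G w \<and> length w' < length w"
proof -
  from not_distinct_decomp[OF nd] obtain xs ys zs y
    where d: "butlast w = xs @ [y] @ ys @ [y] @ zs" by blast
  have wne: "w \<noteq> []" using w by (simp add: is_tour_def)
  have w1: "w = xs @ [y] @ ys @ [y] @ zs @ [last w]"
    using append_butlast_last_id[OF wne] d by simp
  obtain q b where qb: "zs @ [last w] = q # b" by (cases "zs @ [last w]") auto
  have "successively (\<noteq>) (xs @ [y] @ ys @ [y] @ zs @ [last w])"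
    using w w1 by (simp add: is_tour_def)
  then have "ys \<noteq> []" by (auto simp: successively_append_iff)
  then obtain ys' p where ys: "ys = ys' @ [p]" by (metis append_butlast_last_id)
  define a where "a = xs @ [y] @ ys'"
  have a: "a \<noteq> []" "y \<in> set a" by (auto simp: a_def)
  have w2: "w = a @ p # y # q # b" using w1 qb by (simp add: a_def ys)
  have suc: "successively (\<noteq>) (a @ [p])" "p \<noteq> y" "y \<noteq> q" "successively (\<noteq>) (q # b)"
    using w unfolding is_tour_def w2 by (auto simp: successively_append_iff)
  have V: "p \<in> verts G" "y \<in> verts G" "q \<in> verts G"
    using w unfolding is_tour_def w2 by auto
  have cw: "walk_cost G w = walk_cost G (a @ [p]) + dist G p y + dist G y q + walk_cost G (q # b)"
    unfolding w2 by (subst walk_cost_append) (simp add: walk_cost_def)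
  show ?thesis
  proof (cases "p = q")
    case True
    let ?w = "a @ p # b"
    have "is_tour G V' ?w"
      using w suc a unfolding is_tour_def w2 True
      by (auto simp: successively_append_iff successively_Cons)
    moreover have "walk_cost G ?w \<le> walk_cost G w"
    proof -
      have "dist G p y \<ge> 0" "dist G y q \<ge> 0"
        using G V suc by (auto simp: metric_network_def)
      then show ?thesis unfolding cw by (subst walk_cost_append) (simp add: True)
    qed
    ultimately show ?thesis by (intro exI[of _ ?w]) (simp add: w2)
  next
    case False
    let ?w = "a @ p # q # b"
    have "is_tour G V' ?w"
      using w suc a False unfolding is_tour_def w2
      by (auto simp: successively_append_iff successively_Cons)
    moreover have "walk_cost G ?w \<le> walk_cost G w"
    proof -
      have "dist G p q \<le> dist G p y + dist G y q"
        using G V suc False by (auto simp: metric_network_def)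
      then show ?thesis unfolding cw by (subst walk_cost_append) (simp add: walk_cost_def)
    qed
    ultimately show ?thesis by (intro exI[of _ ?w]) (simp add: w2)
  qed
qed

lemma short_tour:
  assumes "metric_network G" "is_tour G V' w"
  shows "\<exists>w'. is_tour G V' w' \<and> walk_cost G w' \<le> walk_cost G w \<and> length w' \<le> Suc (card (verts G))"
  using assms(2)
proof (induction "length w" arbitrary: w rule: less_induct)
  case less
  show ?case
  proof (cases "distinct (butlast w)")
    case True
    have "finite (verts G)" using assms(1) by (simp add: metric_network_def)
    moreover have "set (butlast w) \<subseteq> verts G"
      using less.prems by (auto simp: is_tour_def dest: in_set_butlastD)
    ultimately have "length (butlast w) \<le> card (verts G)"
      using True by (metis card_mono distinct_card)
    then show ?thesis using less.prems by (intro exI[of _ w]) simp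
  next
    case False
    from tour_shortcut[OF assms(1) less.prems False] less.hyps show ?thesis
      by (meson order_trans)
  qed
qed

lemma tour_exists:
  assumes "metric_network G" "V' \<subseteq> verts G"
  shows "\<exists>w. is_tour G V' w"
proof -
  define xs where "xs = sorted_list_of_set (verts G - {start G})"
  have fin: "finite (verts G)" "start G \<in> verts G" using assms(1) by (auto simp: metric_network_def)
  have xs: "set xs = verts G - {start G}" "distinct xs" using fin by (auto simp: xs_def)
  have suc: "successively (\<noteq>) xs"
    using xs(2) by (auto simp: successively_conv_nth distinct_conv_nth)
  show ?thesis
  proof (cases "xs = []")
    case True
    then show ?thesis using assms fin xs by (intro exI[of _ "[start G]"]) (auto simp: is_tour_def)
  next
    case False
    then have "start G \<noteq> hd xs" "last xs \<noteq> start G"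
      using xs(1) hd_in_set[OF False] last_in_set[OF False] by auto
    then show ?thesis using assms fin xs suc False
      by (intro exI[of _ "start G # xs @ [start G]"])
        (auto simp: is_tour_def successively_append_iff successively_Cons)
  qed
qed

lemma opt_tour_cost_attained:
  assumes "metric_network G" "V' \<subseteq> verts G"
  shows "\<exists>w. is_tour G V' w \<and> walk_cost G w = opt_tour_cost G V'"
proof -
  define C where "C = walk_cost G ` {w. is_tour G V' w \<and> length w \<le> Suc (card (verts G))}"
  have "finite {w. set w \<subseteq> verts G \<and> length w \<le> Suc (card (verts G))}"
    using assms(1) by (intro finite_lists_length_le) (simp add: metric_network_def)
  then have "finite C" unfolding C_def
    by (intro finite_imageI) (erule rev_finite_subset, auto simp: is_tour_def)
  moreover have "C \<noteq> {}"
    using tour_exists[OF assms] short_tour[OF assms(1)] by (fastforce simp: C_def)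
  ultimately have min: "Min C \<in> C" "\<And>c. c \<in> C \<Longrightarrow> Min C \<le> c" by auto
  have "opt_tour_cost G V' = Min C" unfolding opt_tour_cost_def
  proof (rule cInf_eq_minimum)
    show "Min C \<in> {walk_cost G w |w. is_tour G V' w}" using min(1) by (auto simp: C_def)
    fix x assume "x \<in> {walk_cost G w |w. is_tour G V' w}"
    then obtain w where "is_tour G V' w" "x = walk_cost G w" by auto
    with short_tour[OF assms(1)] obtain w' where
      "is_tour G V' w'" "walk_cost G w' \<le> x" "length w' \<le> Suc (card (verts G))" by blast
    then have "walk_cost G w' \<in> C" "walk_cost G w' \<le> x" by (auto simp: C_def)
    then show "Min C \<le> x" using min(2) by force
  qed
  then show ?thesis using min(1) by (auto simp: C_def)
qed


text \<open>
  Agents are \<open>1, \<dots>, num_agents I\<close>, agent types \<open>1, \<dots>, num_types I\<close>; \<open>tasks I 0\<close> are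
  the generic tasks and \<open>tasks I i\<close> the tasks specific to type \<open>i\<close>.
\<close>

record htap =
  num_agents :: nat
  num_types :: nat
  type_of :: "nat \<Rightarrow> nat"
  tasks :: "nat \<Rightarrow> nat set"
  depot :: nat
  distance :: "nat \<Rightarrow> nat \<Rightarrow> real"

definition all_tasks :: "htap \<Rightarrow> nat set" where
  "all_tasks I = (\<Union>i\<in>{0..num_types I}. tasks I i)"

definition htap_network :: "htap \<Rightarrow> network" where
  "htap_network I =
     \<lparr>start = depot I, verts = insert (depot I) (all_tasks I), dist = distance I\<rparr>"

definition htap_instance :: "htap \<Rightarrow> bool" where
  "htap_instance I \<longleftrightarrow>
     num_agents I \<ge> 1 \<and>
     type_of I ` {1..num_agents I} = {1..num_types I} \<and>
     (\<forall>i\<in>{0..num_types I}. \<forall>i'\<in>{0..num_types I}. i \<noteq> i' \<longrightarrow> tasks I i \<inter> tasks I i' = {}) \<and>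
     depot I \<notin> all_tasks I \<and>
     metric_network (htap_network I)"

definition feasible_allocation :: "htap \<Rightarrow> (nat \<Rightarrow> nat set) \<Rightarrow> bool" where
  "feasible_allocation I S \<longleftrightarrow>
     (\<Union>j\<in>{1..num_agents I}. S j) = all_tasks I \<and>
     (\<forall>j\<in>{1..num_agents I}. \<exists>V R. S j = V \<union> R \<and> V \<subseteq> tasks I (type_of I j) \<and> R \<subseteq> tasks I 0)"

definition htap_opt :: "htap \<Rightarrow> real" where
  "htap_opt I =
     Min {Max ((\<lambda>j. opt_tour_cost (htap_network I) (S j)) ` {1..num_agents I}) |S.
            feasible_allocation I S}"

definition feasible_solution :: "htap \<Rightarrow> (nat \<Rightarrow> nat set) \<Rightarrow> (nat \<Rightarrow> nat list) \<Rightarrow> bool" where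
  "feasible_solution I S w \<longleftrightarrow>
     feasible_allocation I S \<and>
     (\<forall>j\<in>{1..num_agents I}. is_tour (htap_network I) (S j) (w j))"

definition solution_value :: "htap \<Rightarrow> (nat \<Rightarrow> nat list) \<Rightarrow> real" where
  "solution_value I w = Max ((\<lambda>j. walk_cost (htap_network I) (w j)) ` {1..num_agents I})"


text \<open>
  Programs work on S-expressions whose atoms are numbers. Two cost models are provided: the real
  RAM (every operation on real numbers takes unit time and every real occupies one cell), and the
  bit model, in which distances are rational, numbers are measured by the length of their
  binary representation and the cost of arithmetic depends on it. Constructing a pair takes unit
  time in both models, as pairs can be shared.
\<close>

datatype cost_model = Real_RAM | Bit_Model

fun admissible_numbers :: "cost_model \<Rightarrow> real set" where
  "admissible_numbers Real_RAM = UNIV"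
| "admissible_numbers Bit_Model = \<rat>"

definition rat_bits :: "rat \<Rightarrow> nat" where
  "rat_bits q = (case quotient_of q of (a, b) \<Rightarrow> Suc (nat (bitlen \<bar>a\<bar> + bitlen b)))"

text \<open>
  In the bit model irrational numbers never arise from rational input, so their size is
  irrelevant.
\<close>

fun number_size :: "cost_model \<Rightarrow> real \<Rightarrow> nat" where
  "number_size Real_RAM x = 1"
| "number_size Bit_Model x = (if x \<in> \<rat> then rat_bits (THE q. x = of_rat q) else 1)"

datatype val = Null | Num real | Pair val val

fun val_size :: "cost_model \<Rightarrow> val \<Rightarrow> nat" where
  "val_size M Null = 1"
| "val_size M (Num x) = number_size M x"
| "val_size M (Pair a b) = Suc (val_size M a + val_size M b)"

fun atom_size :: "cost_model \<Rightarrow> val \<Rightarrow> nat" where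
  "atom_size M (Num x) = number_size M x"
| "atom_size M _ = 1"

type_synonym vname = string
type_synonym store = "vname \<Rightarrow> val"

datatype arith_op = Add | Sub | Mul | Div

datatype expr =
    Var vname
  | Const int
  | Empty
  | MkPair expr expr
  | Head expr
  | Tail expr
  | IsPair expr
  | IsNum expr
  | IsNull expr
  | Arith arith_op expr expr
  | Less expr expr
  | Equal expr expr

text \<open>Truth values: \<open>Null\<close> is false, every other value is true.\<close>

definition val_of_bool :: "bool \<Rightarrow> val" where
  "val_of_bool b = (if b then Num 1 else Null)"

fun apply_op :: "arith_op \<Rightarrow> real \<Rightarrow> real \<Rightarrow> real" where
  "apply_op Add x y = x + y"
| "apply_op Sub x y = x - y"
| "apply_op Mul x y = x * y"
| "apply_op Div x y = x / y"

fun eval_expr :: "store \<Rightarrow> expr \<Rightarrow> val" where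
  "eval_expr s (Var x) = s x"
| "eval_expr s (Const i) = Num (of_int i)"
| "eval_expr s Empty = Null"
| "eval_expr s (MkPair a b) = Pair (eval_expr s a) (eval_expr s b)"
| "eval_expr s (Head a) = (case eval_expr s a of Pair u v \<Rightarrow> u | _ \<Rightarrow> Null)"
| "eval_expr s (Tail a) = (case eval_expr s a of Pair u v \<Rightarrow> v | _ \<Rightarrow> Null)"
| "eval_expr s (IsPair a) = val_of_bool (case eval_expr s a of Pair u v \<Rightarrow> True | _ \<Rightarrow> False)"
| "eval_expr s (IsNum a) = val_of_bool (case eval_expr s a of Num x \<Rightarrow> True | _ \<Rightarrow> False)"
| "eval_expr s (IsNull a) = val_of_bool (eval_expr s a = Null)"
| "eval_expr s (Arith f a b) =
     (case (eval_expr s a, eval_expr s b) of (Num x, Num y) \<Rightarrow> Num (apply_op f x y) | _ \<Rightarrow> Null)"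
| "eval_expr s (Less a b) =
     val_of_bool (case (eval_expr s a, eval_expr s b) of (Num x, Num y) \<Rightarrow> x < y | _ \<Rightarrow> False)"
| "eval_expr s (Equal a b) =
     val_of_bool (case (eval_expr s a, eval_expr s b) of (Num x, Num y) \<Rightarrow> x = y | _ \<Rightarrow> False)"

fun expr_time :: "cost_model \<Rightarrow> store \<Rightarrow> expr \<Rightarrow> nat" where
  "expr_time M s (Var x) = 1"
| "expr_time M s (Const i) = 1"
| "expr_time M s Empty = 1"
| "expr_time M s (MkPair a b) = Suc (expr_time M s a + expr_time M s b)"
| "expr_time M s (Head a) = Suc (expr_time M s a)"
| "expr_time M s (Tail a) = Suc (expr_time M s a)"
| "expr_time M s (IsPair a) = Suc (expr_time M s a)"
| "expr_time M s (IsNum a) = Suc (expr_time M s a)"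
| "expr_time M s (IsNull a) = Suc (expr_time M s a)"
| "expr_time M s (Arith f a b) =
     expr_time M s a + expr_time M s b + atom_size M (eval_expr s a) + atom_size M (eval_expr s b)"
| "expr_time M s (Less a b) =
     expr_time M s a + expr_time M s b + atom_size M (eval_expr s a) + atom_size M (eval_expr s b)"
| "expr_time M s (Equal a b) =
     expr_time M s a + expr_time M s b + atom_size M (eval_expr s a) + atom_size M (eval_expr s b)"

text \<open>
  \<open>Call x P e\<close> runs the program \<open>P\<close> as a subroutine: \<open>P\<close> starts in a fresh store holding the value
  of \<open>e\<close> in its variable \<open>in\<close>, and the final value of its variable \<open>out\<close> is assigned to \<open>x\<close>.
\<close>

datatype com =
    Skip
  | Assign vname expr  (infix "::=" 61)
  | Seq com com  (infixr ";;" 60)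
  | Cond expr com com
  | While expr com
  | Call vname com expr

definition init_store :: "val \<Rightarrow> store" where
  "init_store v = (\<lambda>_. Null)(''in'' := v)"

inductive exec :: "cost_model \<Rightarrow> com \<Rightarrow> store \<Rightarrow> nat \<Rightarrow> store \<Rightarrow> bool" for M where
  Skip: "exec M Skip s 1 s"
| Assign: "exec M (x ::= e) s (Suc (expr_time M s e)) (s(x := eval_expr s e))"
| Seq: "exec M c s t s' \<Longrightarrow> exec M c' s' t' s'' \<Longrightarrow> exec M (c ;; c') s (t + t') s''"
| CondTrue: "eval_expr s e \<noteq> Null \<Longrightarrow> exec M c s t s' \<Longrightarrow>
    exec M (Cond e c c') s (Suc (expr_time M s e + t)) s'"
| CondFalse: "eval_expr s e = Null \<Longrightarrow> exec M c' s t s' \<Longrightarrow>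
    exec M (Cond e c c') s (Suc (expr_time M s e + t)) s'"
| WhileFalse: "eval_expr s e = Null \<Longrightarrow> exec M (While e c) s (Suc (expr_time M s e)) s"
| WhileTrue: "eval_expr s e \<noteq> Null \<Longrightarrow> exec M c s t s' \<Longrightarrow> exec M (While e c) s' t' s'' \<Longrightarrow>
    exec M (While e c) s (Suc (expr_time M s e + t + t')) s''"
| Call: "exec M P (init_store (eval_expr s e)) t s' \<Longrightarrow>
    exec M (Call x P e) s (Suc (expr_time M s e + t)) (s(x := s' ''out''))"

definition runs :: "cost_model \<Rightarrow> com \<Rightarrow> val \<Rightarrow> nat \<Rightarrow> val \<Rightarrow> bool" where
  "runs M P v t r \<longleftrightarrow> (\<exists>s. exec M P (init_store v) t s \<and> s ''out'' = r)"

text \<open>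
  \<open>solves_in_poly_time M P X good\<close>: on every input \<open>v \<in> X\<close> the program \<open>P\<close> halts with an output
  \<open>r\<close> such that \<open>good v r\<close>, in time polynomial in the size of \<open>v\<close>. (Programs are deterministic.)
\<close>

definition solves_in_poly_time ::
  "cost_model \<Rightarrow> com \<Rightarrow> val set \<Rightarrow> (val \<Rightarrow> val \<Rightarrow> bool) \<Rightarrow> bool" where
  "solves_in_poly_time M P X good \<longleftrightarrow>
     (\<exists>p :: nat poly. \<forall>v\<in>X. \<exists>t r. runs M P v t r \<and> t \<le> poly p (val_size M v) \<and> good v r)"


definition val_of_nat :: "nat \<Rightarrow> val" where
  "val_of_nat n = Num (real n)"

fun val_of_list :: "val list \<Rightarrow> val" where
  "val_of_list [] = Null"
| "val_of_list (v # vs) = Pair v (val_of_list vs)"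

definition val_of_nats :: "nat list \<Rightarrow> val" where
  "val_of_nats xs = val_of_list (map val_of_nat xs)"

text \<open>A set is represented by any list enumerating it without repetitions.\<close>

definition encodes_set :: "val \<Rightarrow> nat set \<Rightarrow> bool" where
  "encodes_set v A \<longleftrightarrow> (\<exists>xs. distinct xs \<and> set xs = A \<and> v = val_of_nats xs)"

definition encodes_network :: "val \<Rightarrow> network \<Rightarrow> bool" where
  "encodes_network v G \<longleftrightarrow>
     (\<exists>vs. distinct vs \<and> set vs = verts G \<and>
        v = Pair (val_of_nat (start G))
              (Pair (val_of_nats vs)
                 (val_of_list [Pair (val_of_nat a) (Pair (val_of_nat b) (Num (dist G a b))).
                               a \<leftarrow> vs, b \<leftarrow> vs, a \<noteq> b])))"

definition encodes_tour_input :: "val \<Rightarrow> network \<Rightarrow> nat set \<Rightarrow> bool" where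
  "encodes_tour_input v G V' \<longleftrightarrow>
     (\<exists>g s. encodes_network g G \<and> encodes_set s V' \<and> v = Pair g s)"

text \<open>
  An instance is given by the graph, the generic tasks, the list of the types of all agents, and a
  table assigning to each type its specific tasks.
\<close>

definition encodes_htap :: "val \<Rightarrow> htap \<Rightarrow> bool" where
  "encodes_htap v I \<longleftrightarrow>
     (\<exists>g c. encodes_network g (htap_network I) \<and>
        (\<forall>i\<in>{0..num_types I}. encodes_set (c i) (tasks I i)) \<and>
        v = Pair g (Pair (c 0)
              (Pair (val_of_nats (map (type_of I) [1..<Suc (num_agents I)]))
                 (val_of_list (map (\<lambda>i. Pair (val_of_nat i) (c i)) [1..<Suc (num_types I)])))))"

definition val_of_tours :: "nat \<Rightarrow> (nat \<Rightarrow> nat list) \<Rightarrow> val" where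
  "val_of_tours k w = val_of_list (map (\<lambda>j. val_of_nats (w j)) [1..<Suc k])"


definition admissible_network :: "cost_model \<Rightarrow> network \<Rightarrow> bool" where
  "admissible_network M G \<longleftrightarrow>
     (\<forall>u\<in>verts G. \<forall>v\<in>verts G. u \<noteq> v \<longrightarrow> dist G u v \<in> admissible_numbers M)"

definition tour_approximation :: "cost_model \<Rightarrow> real \<Rightarrow> com \<Rightarrow> bool" where
  "tour_approximation M \<alpha> P \<longleftrightarrow>
     solves_in_poly_time M P
       {v. \<exists>G V'. metric_network G \<and> admissible_network M G \<and> V' \<subseteq> verts G \<and>
             encodes_tour_input v G V'}
       (\<lambda>v r. \<forall>G V'. metric_network G \<and> admissible_network M G \<and> V' \<subseteq> verts G \<and>
             encodes_tour_input v G V' \<longrightarrow>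
             (\<exists>w. r = val_of_nats w \<and> is_tour G V' w \<and> walk_cost G w \<le> \<alpha> * opt_tour_cost G V'))"

text \<open>
  The approximation factor may depend on the instance. The program returns the tours; the
  allocation they belong to is existentially quantified.
\<close>

definition htap_approximation :: "cost_model \<Rightarrow> (htap \<Rightarrow> real) \<Rightarrow> com \<Rightarrow> bool" where
  "htap_approximation M \<rho> P \<longleftrightarrow>
     solves_in_poly_time M P
       {v. \<exists>I. htap_instance I \<and> admissible_network M (htap_network I) \<and> encodes_htap v I}
       (\<lambda>v r. \<forall>I. htap_instance I \<and> admissible_network M (htap_network I) \<and> encodes_htap v I \<longrightarrow>
             (\<exists>S w. r = val_of_tours (num_agents I) w \<and> feasible_solution I S w \<and>
                    solution_value I w \<le> \<rho> I * htap_opt I))"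


text \<open>
  The main loop runs through the agents, the variable \<open>agents\<close> holding the types of those not yet
  processed. At the start of the iteration for agent \<open>A\<^sub>j\<close> the variable \<open>jobs\<close> holds \<open>T\<^sub>0\<close> if
  \<open>j = 1\<close>, and the empty list otherwise.
\<close>

definition naive_allocation :: "com \<Rightarrow> com" where
  "naive_allocation tour_alg =
     ''graph'' ::= Head (Var ''in'') ;;
     ''jobs'' ::= Head (Tail (Var ''in'')) ;;
     ''agents'' ::= Head (Tail (Tail (Var ''in''))) ;;
     ''table'' ::= Tail (Tail (Tail (Var ''in''))) ;;
     ''done'' ::= Empty ;;
     While (Var ''agents'') (
       ''entry'' ::= Var ''table'' ;;
       While (IsNull (Equal (Head (Head (Var ''entry''))) (Head (Var ''agents'')))) (
         ''entry'' ::= Tail (Var ''entry'')) ;;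
       ''own'' ::= Tail (Head (Var ''entry'')) ;;
       While (Var ''own'') (
         ''jobs'' ::= MkPair (Head (Var ''own'')) (Var ''jobs'') ;;
         ''own'' ::= Tail (Var ''own'')) ;;
       Call ''tour'' tour_alg (MkPair (Var ''graph'') (Var ''jobs'')) ;;
       ''done'' ::= MkPair (Var ''tour'') (Var ''done'') ;;
       ''jobs'' ::= Empty ;;
       ''agents'' ::= Tail (Var ''agents'')) ;;
     ''out'' ::= Empty ;;
     While (Var ''done'') (
       ''out'' ::= MkPair (Head (Var ''done'')) (Var ''out'') ;;
       ''done'' ::= Tail (Var ''done''))"

end

theory Submission
  imports Defs
begin

text \<open>
  Concatenating the tours of an optimal solution gives a tour on all tasks of cost at most \<open>k\<close> times
  the optimum, and every set of tasks allocated by \<^const>\<open>naive_allocation\<close> is a subset of all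
  tasks. The factor \<open>\<alpha>\<close> is nonnegative, as a network with two vertices shows, so the tours returned
  cost at most \<open>\<alpha> k\<close> times the optimum.
\<close>

section \<open>Costs of tours\<close>

text \<open>The cost bound is the shorter half; the rest shows that the concrete program halts in
  polynomial time and computes this allocation. The tour algorithm is an arbitrary program known
  only by its runs on valid encodings, so each of its inputs must be shown to be one. An encoded set
  is a list without repetitions, and the program merely prepends lists; disjointness of generic and
  type-specific tasks keeps the result valid. Each such input has size linear in that of the
  instance, so composing the polynomial of the tour algorithm with a linear one bounds each call,
  and there are at most as many calls as the size of the instance.\<close>

lemma walk_cost_nonneg:
  assumes "metric_network G" "set w \<subseteq> verts G" "successively (\<noteq>) w"
  shows "walk_cost G w \<ge> 0"
  using assms(2,3)
proof (induction w rule: induct_list012)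
  case (3 x y zs)
  then have "dist G x y \<ge> 0" using assms(1) by (auto simp: metric_network_def)
  with 3 show ?case by (auto simp: walk_cost_def)
qed (auto simp: walk_cost_def)

lemma opt_tour_cost_le:
  assumes "metric_network G" "is_tour G V' w"
  shows "opt_tour_cost G V' \<le> walk_cost G w"
  unfolding opt_tour_cost_def
proof (rule cInf_lower)
  \<comment> \<open>A real \<open>Inf\<close> is known to be a lower bound only when the set is
    bounded below; nonnegative edge weights supply the bound 0.\<close>
  show "bdd_below {walk_cost G w |w. is_tour G V' w}"
    using walk_cost_nonneg[OF assms(1)] by (auto simp: is_tour_def intro!: bdd_belowI[where m = 0])
qed (use assms in auto)

lemma opt_tour_cost_nonneg:
  assumes "metric_network G" "V' \<subseteq> verts G"
  shows "opt_tour_cost G V' \<ge> 0"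
proof -
  obtain w where "is_tour G V' w" "walk_cost G w = opt_tour_cost G V'"
    using opt_tour_cost_attained[OF assms] by blast
  then show ?thesis using walk_cost_nonneg[OF assms(1), of w] by (simp add: is_tour_def)
qed

lemma opt_tour_cost_mono:
  assumes "metric_network G" "A \<subseteq> B" "B \<subseteq> verts G"
  shows "opt_tour_cost G A \<le> opt_tour_cost G B"
proof -
  obtain w where "is_tour G B w" "walk_cost G w = opt_tour_cost G B"
    using opt_tour_cost_attained[OF assms(1,3)] by blast
  moreover from this have "is_tour G A w" using assms(2) by (auto simp: is_tour_def)
  ultimately show ?thesis using opt_tour_cost_le[OF assms(1)] by metis
qed

lemma opt_tour_cost_empty:
  assumes "metric_network G"
  shows "opt_tour_cost G {} = 0"
proof -
  have "is_tour G {} [start G]" using assms by (auto simp: is_tour_def metric_network_def)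
  then have "opt_tour_cost G {} \<le> 0"
    using opt_tour_cost_le[OF assms] by (fastforce simp: walk_cost_def)
  then show ?thesis using opt_tour_cost_nonneg[OF assms, of "{}"] by simp
qed

lemma opt_tour_cost_Un:
  assumes G: "metric_network G" and "A \<subseteq> verts G" "B \<subseteq> verts G"
  shows "opt_tour_cost G (A \<union> B) \<le> opt_tour_cost G A + opt_tour_cost G B"
proof -
  obtain u where u: "is_tour G A u" "walk_cost G u = opt_tour_cost G A"
    using opt_tour_cost_attained assms by blast
  obtain w where w: "is_tour G B w" "walk_cost G w = opt_tour_cost G B"
    using opt_tour_cost_attained assms by blast
  obtain a where a: "u = a @ [start G]"
    using u(1) by (metis append_butlast_last_id is_tour_def)
  obtain b where b: "w = start G # b"
    using w(1) by (metis list.collapse is_tour_def)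
  \<comment> \<open>The end of \<open>u\<close> and the beginning of \<open>w\<close> become a
    single occurrence of the start; two adjacent copies would violate
    \<open>successively (\<noteq>)\<close>.\<close>
  have "is_tour G (A \<union> B) (a @ start G # b)"
    using u(1) w(1) unfolding is_tour_def a b
    by (auto simp: successively_append_iff successively_Cons hd_append)
  then have "opt_tour_cost G (A \<union> B) \<le> walk_cost G (a @ start G # b)"
    using opt_tour_cost_le[OF G] by blast
  also have "\<dots> = walk_cost G u + walk_cost G w"
    unfolding a b by (rule walk_cost_append)
  finally show ?thesis using u w by simp
qed

lemma opt_tour_cost_UN:
  assumes "metric_network G" "finite J" "\<And>j. j \<in> J \<Longrightarrow> S j \<subseteq> verts G"
  shows "opt_tour_cost G (\<Union>j\<in>J. S j) \<le> (\<Sum>j\<in>J. opt_tour_cost G (S j))"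
  using assms(2,3)
proof (induction J rule: finite_induct)
  case empty
  show ?case by (simp add: opt_tour_cost_empty[OF assms(1)])
next
  case (insert j J)
  have "(\<Union>j\<in>J. S j) \<subseteq> verts G" "S j \<subseteq> verts G" using insert.prems by auto
  then have "opt_tour_cost G (S j \<union> (\<Union>j\<in>J. S j)) \<le>
      opt_tour_cost G (S j) + opt_tour_cost G (\<Union>j\<in>J. S j)"
    by (intro opt_tour_cost_Un[OF assms(1)])
  also have "opt_tour_cost G (\<Union>j\<in>J. S j) \<le> (\<Sum>j\<in>J. opt_tour_cost G (S j))"
    using insert.IH insert.prems by simp
  finally show ?case using insert.hyps by simp
qed

text \<open>The sign of \<alpha> is needed to multiply the bound on the optimal tour cost by it.
  With unit distances, admissible in both cost models, any tour reaching the second vertex uses an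
  edge and costs at least 1, so the guarantee makes \<alpha> times a nonnegative optimum
  positive.\<close>

lemma tour_approximation_nonneg:
  assumes "tour_approximation M \<alpha> P"
  shows "\<alpha> \<ge> 0"
proof -
  define G where "G = \<lparr>start = 0, verts = {0, 1}, dist = \<lambda>_ _. 1 :: real\<rparr>"
  have G: "metric_network G" by (auto simp: metric_network_def G_def)
  have adm: "admissible_network M G" by (cases M) (auto simp: admissible_network_def G_def)
  have sub: "{1} \<subseteq> verts G" by (simp add: G_def)
  have "encodes_network (Pair (val_of_nat (start G)) (Pair (val_of_nats [0, 1])
      (val_of_list [Pair (val_of_nat a) (Pair (val_of_nat b) (Num (dist G a b))).
                               a \<leftarrow> [0, 1], b \<leftarrow> [0, 1], a \<noteq> b]))) G"
    unfolding encodes_network_def by (intro exI[of _ "[0, 1]"]) (auto simp: G_def)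
  moreover have "encodes_set (val_of_nats [1]) {1}"
    unfolding encodes_set_def by (intro exI[of _ "[1]"]) auto
  ultimately obtain v where "encodes_tour_input v G {1}"
    unfolding encodes_tour_input_def by blast
  with assms G adm sub obtain w where w: "is_tour G {1} w" "walk_cost G w \<le> \<alpha> * opt_tour_cost G {1}"
    unfolding tour_approximation_def solves_in_poly_time_def by blast
  obtain y b where b: "w = 0 # y # b"
    using w(1) by (cases w; cases "tl w") (auto simp: is_tour_def G_def)
  have "walk_cost G w = 1 + walk_cost G (y # b)" by (simp add: b walk_cost_def G_def)
  moreover have "walk_cost G (y # b) \<ge> 0"
    using w(1) by (intro walk_cost_nonneg[OF G]) (auto simp: is_tour_def b)
  ultimately have "\<alpha> * opt_tour_cost G {1} > 0" using w(2) by simp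
  then show ?thesis
    using opt_tour_cost_nonneg[OF G sub] by (simp add: zero_less_mult_iff)
qed

section \<open>The allocation and its value\<close>

text \<open>The case \<open>j = 1\<close> mirrors the program, where \<open>jobs\<close> initially
  holds the generic tasks and is emptied after each call.\<close>

definition naive_set :: "htap \<Rightarrow> nat \<Rightarrow> nat set" where
  "naive_set I j = tasks I (type_of I j) \<union> (if j = 1 then tasks I 0 else {})"

lemma type_of_bounds:
  assumes "htap_instance I" "j \<in> {1..num_agents I}"
  shows "type_of I j \<in> {1..num_types I}"
  using assms by (auto simp: htap_instance_def)

lemma naive_set_subset:
  assumes "htap_instance I" "j \<in> {1..num_agents I}"
  shows "naive_set I j \<subseteq> all_tasks I"
proof -
  have "tasks I i \<subseteq> all_tasks I" if "i \<le> num_types I" for i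
    using that by (auto simp: all_tasks_def)
  then show ?thesis
    using type_of_bounds[OF assms] unfolding naive_set_def by (cases "j = 1") auto
qed

lemma feasible_naive_set:
  assumes "htap_instance I"
  shows "feasible_allocation I (naive_set I)"
  unfolding feasible_allocation_def
proof (intro conjI ballI)
  show "(\<Union>j\<in>{1..num_agents I}. naive_set I j) = all_tasks I" (is "?U = _")
  proof
    show "?U \<subseteq> all_tasks I" using naive_set_subset[OF assms] by blast
    show "all_tasks I \<subseteq> ?U"
    proof
      fix x assume "x \<in> all_tasks I"
      then obtain i where i: "i \<le> num_types I" "x \<in> tasks I i" by (auto simp: all_tasks_def)
      show "x \<in> ?U"
      proof (cases "i = 0")
        case True
        then show ?thesis
          using i assms by (auto simp: naive_set_def htap_instance_def intro!: bexI[of _ 1])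
      next
        case False
        \<comment> \<open>Every type has at least one agent, so every type-specific task is
          allocated.\<close>
        then have "i \<in> type_of I ` {1..num_agents I}"
          using i assms by (auto simp: htap_instance_def)
        then obtain j where "j \<in> {1..num_agents I}" "i = type_of I j" by blast
        moreover from this have "x \<in> naive_set I j" using i by (simp add: naive_set_def)
        ultimately show ?thesis by blast
      qed
    qed
  qed
next
  fix j
  show "\<exists>V R. naive_set I j = V \<union> R \<and> V \<subseteq> tasks I (type_of I j) \<and> R \<subseteq> tasks I 0"
    unfolding naive_set_def
    by (intro exI[of _ "tasks I (type_of I j)"] exI[of _ "if j = 1 then tasks I 0 else {}"]) auto
qed

text \<open>\<open>Min\<close> is meaningful only on finite nonempty sets. There are infinitely many
  allocations, since \<open>S\<close> is arbitrary outside the agents, but each value is the optimal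
  tour cost of some subset of the finite set of tasks.\<close>

lemma htap_opt_attained:
  assumes "htap_instance I"
  shows "\<exists>S. feasible_allocation I S \<and>
    htap_opt I = Max ((\<lambda>j. opt_tour_cost (htap_network I) (S j)) ` {1..num_agents I})"
proof -
  define X where "X = {Max ((\<lambda>j. opt_tour_cost (htap_network I) (S j)) ` {1..num_agents I}) |S.
            feasible_allocation I S}"
  have ne: "{1..num_agents I} \<noteq> {}" using assms by (auto simp: htap_instance_def)
  have "X \<subseteq> opt_tour_cost (htap_network I) ` Pow (all_tasks I)"
  proof
    fix x assume "x \<in> X"
    then obtain S where S: "feasible_allocation I S"
      "x = Max ((\<lambda>j. opt_tour_cost (htap_network I) (S j)) ` {1..num_agents I})"
      by (auto simp: X_def)
    then have "x \<in> (\<lambda>j. opt_tour_cost (htap_network I) (S j)) ` {1..num_agents I}"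
      using ne by simp
    then show "x \<in> opt_tour_cost (htap_network I) ` Pow (all_tasks I)"
      using S(1) by (auto simp: feasible_allocation_def)
  qed
  moreover have "finite (all_tasks I)"
    using assms by (auto simp: htap_instance_def metric_network_def htap_network_def)
  ultimately have "finite X" by (meson finite_Pow_iff finite_imageI finite_subset)
  moreover have "X \<noteq> {}" using feasible_naive_set[OF assms] by (auto simp: X_def)
  ultimately have "Min X \<in> X" by simp
  then show ?thesis unfolding htap_opt_def X_def[symmetric] by (auto simp: X_def)
qed

lemma opt_tour_cost_all_tasks_le:
  assumes "htap_instance I"
  shows "opt_tour_cost (htap_network I) (all_tasks I) \<le> real (num_agents I) * htap_opt I"
proof -
  let ?C = "opt_tour_cost (htap_network I)"
  obtain S where S: "feasible_allocation I S" "htap_opt I = Max ((\<lambda>j. ?C (S j)) ` {1..num_agents I})"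
    using htap_opt_attained[OF assms] by blast
  have U: "(\<Union>j\<in>{1..num_agents I}. S j) = all_tasks I"
    using S(1) by (auto simp: feasible_allocation_def)
  have "?C (all_tasks I) \<le> (\<Sum>j\<in>{1..num_agents I}. ?C (S j))"
    unfolding U[symmetric]
    using assms U by (intro opt_tour_cost_UN) (auto simp: htap_instance_def htap_network_def)
  also have "\<dots> \<le> real (card {1..num_agents I}) * htap_opt I"
    unfolding S(2) by (rule sum_bounded_above) simp
  finally show ?thesis by simp
qed

lemma naive_solution_value:
  assumes I: "htap_instance I" and "\<alpha> \<ge> 0"
    and w: "\<And>j. j \<in> {1..num_agents I} \<Longrightarrow>
      walk_cost (htap_network I) (w j) \<le> \<alpha> * opt_tour_cost (htap_network I) (naive_set I j)"
  shows "solution_value I w \<le> \<alpha> * real (num_agents I) * htap_opt I"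
proof -
  have G: "metric_network (htap_network I)" "all_tasks I \<subseteq> verts (htap_network I)"
    using I by (auto simp: htap_instance_def htap_network_def)
  have "walk_cost (htap_network I) (w j) \<le> \<alpha> * real (num_agents I) * htap_opt I"
    if j: "j \<in> {1..num_agents I}" for j
  proof -
    have "opt_tour_cost (htap_network I) (naive_set I j) \<le> opt_tour_cost (htap_network I) (all_tasks I)"
      using G naive_set_subset[OF I j] by (intro opt_tour_cost_mono)
    also have "\<dots> \<le> real (num_agents I) * htap_opt I"
      by (rule opt_tour_cost_all_tasks_le[OF I])
    finally show ?thesis
      using w[OF j] \<open>\<alpha> \<ge> 0\<close> by (smt (verit) mult.assoc mult_left_mono)
  qed
  moreover have "{1..num_agents I} \<noteq> {}" using I by (auto simp: htap_instance_def)
  ultimately show ?thesis unfolding solution_value_def by (subst Max_le_iff) auto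
qed

section \<open>Time-bounded execution\<close>

inductive_cases exec_SkipE: "exec M Skip s t s'"
inductive_cases exec_AssignE: "exec M (x ::= e) s t s'"
inductive_cases exec_SeqE: "exec M (c ;; c') s t s'"
inductive_cases exec_CondE: "exec M (Cond e c c') s t s'"
inductive_cases exec_WhileE: "exec M (While e c) s t s'"
inductive_cases exec_CallE: "exec M (Call x P e) s t s'"

text \<open>One input may encode several instances, which differ for instance in distances outside
  the graph. Uniqueness of the run lets a single output serve all of them.\<close>

lemma exec_deterministic:
  "exec M c s t s' \<Longrightarrow> exec M c s u s'' \<Longrightarrow> u = t \<and> s'' = s'"
proof (induction arbitrary: u s'' rule: exec.induct)
  case Skip
  then show ?case by (rule exec_SkipE) simp
next
  case Assign
  then show ?case by (rule exec_AssignE) simp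
next
  case (Seq c s t s' c' t' s2)
  from Seq.prems obtain u1 u2 s1 where
    "exec M c s u1 s1" "exec M c' s1 u2 s''" "u = u1 + u2" by (rule exec_SeqE)
  then show ?case using Seq.IH(1)[of u1 s1] Seq.IH(2)[of u2 s''] by simp
next
  case (CondTrue s e c t s' c')
  from CondTrue.prems CondTrue.hyps(1) obtain u1 where
    "exec M c s u1 s''" "u = Suc (expr_time M s e + u1)" by (elim exec_CondE) simp_all
  then show ?case using CondTrue.IH[of u1 s''] by simp
next
  case (CondFalse s e c' t s' c)
  from CondFalse.prems CondFalse.hyps(1) obtain u1 where
    "exec M c' s u1 s''" "u = Suc (expr_time M s e + u1)" by (elim exec_CondE) simp_all
  then show ?case using CondFalse.IH[of u1 s''] by simp
next
  case (WhileFalse s e c)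
  from WhileFalse.prems show ?case by (rule exec_WhileE) (use WhileFalse.hyps in simp_all)
next
  case (WhileTrue s e c t s' t' s2)
  from WhileTrue.prems obtain u1 u2 s1 where
    "exec M c s u1 s1" "exec M (While e c) s1 u2 s''" "u = Suc (expr_time M s e + u1 + u2)"
    by (rule exec_WhileE) (use WhileTrue.hyps(1) in simp_all)
  then show ?case using WhileTrue.IH(1)[of u1 s1] WhileTrue.IH(2)[of u2 s''] by simp
next
  case (Call P s e t s' x)
  from Call.prems obtain u1 s1 where
    "exec M P (init_store (eval_expr s e)) u1 s1" "u = Suc (expr_time M s e + u1)"
    "s'' = s(x := s1 ''out'')" by (rule exec_CallE)
  then show ?case using Call.IH[of u1 s1] by simp
qed

lemma runs_deterministic: "runs M P v t r \<Longrightarrow> runs M P v t' r' \<Longrightarrow> t' = t \<and> r' = r"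
  unfolding runs_def using exec_deterministic by blast

text \<open>Time enters as an upper bound, so constants can be rounded up and branches of different
  length share one bound.\<close>

definition halts_within ::
  "cost_model \<Rightarrow> com \<Rightarrow> store \<Rightarrow> nat \<Rightarrow> (store \<Rightarrow> bool) \<Rightarrow> bool" where
  "halts_within M c s T Q \<longleftrightarrow> (\<exists>t s'. exec M c s t s' \<and> t \<le> T \<and> Q s')"

lemma halts_within_mono:
  "halts_within M c s T Q \<Longrightarrow> T \<le> T' \<Longrightarrow> (\<And>s'. Q s' \<Longrightarrow> Q' s') \<Longrightarrow> halts_within M c s T' Q'"
  unfolding halts_within_def using order_trans by blast

lemma halts_within_weaken: "halts_within M c s T Q \<Longrightarrow> T \<le> T' \<Longrightarrow> halts_within M c s T' Q"
  by (rule halts_within_mono)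

lemma halts_within_Assign:
  "Q (s(x := eval_expr s e)) \<Longrightarrow> halts_within M (x ::= e) s (Suc (expr_time M s e)) Q"
  unfolding halts_within_def using exec.Assign by blast

text \<open>The claim about the second command is the postcondition of the first, so intermediate
  stores never have to be named.\<close>

lemma halts_within_Seq:
  "halts_within M c s T (\<lambda>s'. halts_within M c' s' T' Q) \<Longrightarrow> halts_within M (c ;; c') s (T + T') Q"
  unfolding halts_within_def using exec.Seq add_mono by metis

lemma halts_within_Assign_Seq:
  "halts_within M c (s(x := eval_expr s e)) T Q \<Longrightarrow>
    halts_within M (x ::= e ;; c) s (Suc (expr_time M s e) + T) Q"
  by (intro halts_within_Seq halts_within_Assign)

lemma halts_within_While_done:
  "eval_expr s e = Null \<Longrightarrow> Q s \<Longrightarrow> halts_within M (While e c) s (Suc (expr_time M s e)) Q"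
  unfolding halts_within_def using exec.WhileFalse by blast

lemma halts_within_While_step:
  assumes "eval_expr s e \<noteq> Null"
    and "halts_within M c s T (\<lambda>s'. halts_within M (While e c) s' T' Q)"
  shows "halts_within M (While e c) s (Suc (expr_time M s e + T + T')) Q"
proof -
  obtain t s' t' s'' where "exec M c s t s'" "t \<le> T" "exec M (While e c) s' t' s''" "t' \<le> T'" "Q s''"
    using assms(2) unfolding halts_within_def by blast
  moreover from this have "exec M (While e c) s (Suc (expr_time M s e + t + t')) s''"
    using exec.WhileTrue assms(1) by blast
  ultimately show ?thesis unfolding halts_within_def
    by (intro exI[of _ "Suc (expr_time M s e + t + t')"] exI[of _ s'']) auto
qed

lemma halts_within_Call:
  assumes "runs M P (eval_expr s e) t r" "Q (s(x := r))"
  shows "halts_within M (Call x P e) s (Suc (expr_time M s e + t)) Q"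
  using assms exec.Call unfolding halts_within_def runs_def by blast

text \<open>Natural coefficients are nonnegative. This replaces the sizes of the individual tour
  inputs by one common bound.\<close>

lemma poly_nat_mono:
  fixes p :: "nat poly"
  shows "x \<le> y \<Longrightarrow> poly p x \<le> poly p y"
  by (induction p) (auto intro: add_mono mult_mono)

section \<open>Sizes of encodings\<close>

lemma val_size_pos: "val_size M v \<ge> 1"
  by (cases v; cases M) (auto simp: rat_bits_def split: prod.split)

lemma length_le_val_size: "length vs \<le> val_size M (val_of_list vs)"
  by (induction vs) auto

lemma val_size_member: "v \<in> set vs \<Longrightarrow> val_size M v \<le> val_size M (val_of_list vs)"
  by (induction vs) auto

lemma val_size_append:
  "val_size M (val_of_list (us @ vs)) \<le> val_size M (val_of_list us) + val_size M (val_of_list vs)"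
  by (induction us) auto

lemma val_size_rev: "val_size M (val_of_list (rev vs)) = val_size M (val_of_list vs)"
proof -
  \<comment> \<open>Written as a sum over the entries, the size is visibly independent of their
    order.\<close>
  have "val_size M (val_of_list us) = Suc (\<Sum>v\<leftarrow>us. Suc (val_size M v))" for us
    by (induction us) auto
  then show ?thesis by (simp add: rev_map[symmetric])
qed

section \<open>Execution of the program\<close>

text \<open>Serves both loops of this shape: prepending the own tasks to \<open>jobs\<close> and
  restoring the order of the tours in \<open>out\<close>. A round costs 2 for the test, 5 for the
  first assignment and 3 for the second; the failing test costs 2.\<close>

lemma move_list_loop:
  assumes "x \<noteq> y"
  shows "s x = val_of_list us \<Longrightarrow> s y = val_of_list vs \<Longrightarrow>
    halts_within M (While (Var x) (y ::= MkPair (Head (Var x)) (Var y) ;; x ::= Tail (Var x))) s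
      (2 + 10 * length us) (\<lambda>s'. s' = s(x := Null, y := val_of_list (rev us @ vs)))"
proof (induction us arbitrary: s vs)
  case Nil
  then show ?case
    by (intro halts_within_mono[OF halts_within_While_done[where Q = "\<lambda>s'. s' = s"]]) auto
next
  case (Cons u us)
  let ?body = "y ::= MkPair (Head (Var x)) (Var y) ;; x ::= Tail (Var x)"
  let ?s = "s(y := val_of_list (u # vs), x := val_of_list us)"
  let ?Q = "\<lambda>s'. s' = s(x := Null, y := val_of_list (rev (u # us) @ vs))"
  have "halts_within M (While (Var x) ?body) ?s (2 + 10 * length us)
      (\<lambda>s'. s' = ?s(x := Null, y := val_of_list (rev us @ u # vs)))"
    by (rule Cons.IH) (use assms in auto)
  then have IH: "halts_within M (While (Var x) ?body) ?s (2 + 10 * length us) ?Q"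
    by (rule halts_within_mono) (use assms in \<open>auto simp: fun_eq_iff\<close>)
  have step: "halts_within M ?body s (Suc (expr_time M s (MkPair (Head (Var x)) (Var y))) +
      Suc (expr_time M (s(y := val_of_list (u # vs))) (Tail (Var x))))
      (\<lambda>s'. halts_within M (While (Var x) ?body) s' (2 + 10 * length us) ?Q)"
    by (rule halts_within_Assign_Seq, rule halts_within_mono[OF halts_within_Assign])
      (use IH Cons.prems assms in auto)
  show ?case
    by (rule halts_within_weaken[OF halts_within_While_step[OF _ step]]) (use Cons.prems in simp_all)
qed

text \<open>The search ends because the type occurs in the table. A round costs at most 7 + 2
  \<open>N\<close> for the test, where 2 \<open>N\<close> pays for comparing two numbers in the bit
  model, and 3 for the step. The final test fits into the budget of the matching entry.\<close>

lemma find_entry_loop: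
  assumes "s ''entry'' = val_of_list (map (\<lambda>i. Pair (val_of_nat i) (c i)) ids)"
    and "s ''agents'' = Pair (val_of_nat i) as" "i \<in> set ids"
    and "\<And>i. i \<in> set ids \<Longrightarrow> number_size M (real i) \<le> N"
  shows "halts_within M
    (While (IsNull (Equal (Head (Head (Var ''entry''))) (Head (Var ''agents''))))
       (''entry'' ::= Tail (Var ''entry''))) s
    (length ids * (10 + 2 * N))
    (\<lambda>s'. \<exists>rest. s' = s(''entry'' := Pair (Pair (val_of_nat i) (c i)) rest))"
  using assms
proof (induction ids arbitrary: s)
  case Nil
  then show ?case by simp
next
  case (Cons j ids)
  let ?loop = "While (IsNull (Equal (Head (Head (Var ''entry''))) (Head (Var ''agents''))))
       (''entry'' ::= Tail (Var ''entry''))"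
  let ?Q = "\<lambda>s'. \<exists>rest. s' = s(''entry'' := Pair (Pair (val_of_nat i) (c i)) rest)"
  have N: "number_size M (real i) \<le> N" "number_size M (real j) \<le> N"
    using Cons.prems(3,4) by auto
  show ?case
  proof (cases "j = i")
    case True
    let ?rest = "val_of_list (map (\<lambda>i. Pair (val_of_nat i) (c i)) ids)"
    have "s = s(''entry'' := Pair (Pair (val_of_nat i) (c i)) ?rest)"
      using Cons.prems True by (simp add: fun_upd_idem)
    then have "?Q s" by blast
    moreover have "eval_expr s (IsNull (Equal (Head (Head (Var ''entry''))) (Head (Var ''agents'')))) = Null"
      using Cons.prems True by (simp add: val_of_bool_def val_of_nat_def)
    ultimately show ?thesis using Cons.prems(1,2) True N
      by (intro halts_within_mono[OF halts_within_While_done[where Q = ?Q]])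
        (assumption | simp add: val_of_nat_def)+
  next
    case False
    let ?s = "s(''entry'' := val_of_list (map (\<lambda>i. Pair (val_of_nat i) (c i)) ids))"
    have "halts_within M ?loop ?s (length ids * (10 + 2 * N))
        (\<lambda>s'. \<exists>rest. s' = ?s(''entry'' := Pair (Pair (val_of_nat i) (c i)) rest))"
      by (rule Cons.IH) (use Cons.prems False in auto)
    then have "halts_within M ?loop ?s (length ids * (10 + 2 * N)) ?Q"
      by (simp only: fun_upd_upd)
    then have "halts_within M (''entry'' ::= Tail (Var ''entry'')) s 3
        (\<lambda>s'. halts_within M ?loop s' (length ids * (10 + 2 * N)) ?Q)"
      using Cons.prems(1) by (intro halts_within_mono[OF halts_within_Assign]) auto
    from halts_within_While_step[OF _ this] have "halts_within M ?loop s (Suc (expr_time M s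
        (IsNull (Equal (Head (Head (Var ''entry''))) (Head (Var ''agents'')))) + 3 +
        length ids * (10 + 2 * N))) ?Q"
      using Cons.prems(1,2) False by (simp add: val_of_bool_def val_of_nat_def)
    then show ?thesis
      by (rule halts_within_weaken) (use Cons.prems(1,2) N in \<open>simp add: val_of_nat_def\<close>)
  qed
qed

abbreviation agent_step :: "com \<Rightarrow> com" where
  "agent_step P \<equiv>
     ''entry'' ::= Var ''table'' ;;
     While (IsNull (Equal (Head (Head (Var ''entry''))) (Head (Var ''agents'')))) (
       ''entry'' ::= Tail (Var ''entry'')) ;;
     ''own'' ::= Tail (Head (Var ''entry'')) ;;
     While (Var ''own'') (
       ''jobs'' ::= MkPair (Head (Var ''own'')) (Var ''jobs'') ;;
       ''own'' ::= Tail (Var ''own'')) ;;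
     Call ''tour'' P (MkPair (Var ''graph'') (Var ''jobs'')) ;;
     ''done'' ::= MkPair (Var ''tour'') (Var ''done'') ;;
     ''jobs'' ::= Empty ;;
     ''agents'' ::= Tail (Var ''agents'')"

lemma agent_step_halts:
  assumes s: "s ''graph'' = g" "s ''jobs'' = val_of_list js"
      "s ''agents'' = Pair (val_of_nat i) as"
      "s ''table'' = val_of_list (map (\<lambda>i. Pair (val_of_nat i) (val_of_list (L i))) ids)"
    and i: "i \<in> set ids" "\<And>i. i \<in> set ids \<Longrightarrow> number_size M (real i) \<le> N"
    and N: "length ids \<le> N" "length (L i) \<le> N"
    and run: "runs M P (Pair g (val_of_list (rev (L i) @ js))) t r" "t \<le> D"
  shows "halts_within M (agent_step P) s (N * (20 + 2 * N) + D + 30)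
    (\<lambda>s'. s' ''graph'' = g \<and> s' ''jobs'' = Null \<and> s' ''agents'' = as \<and>
          s' ''table'' = s ''table'' \<and> s' ''done'' = Pair r (s ''done''))"
    (is "halts_within M _ s _ ?Q")
proof -
  let ?c3 = "''done'' ::= MkPair (Var ''tour'') (Var ''done'') ;;
     ''jobs'' ::= Empty ;; ''agents'' ::= Tail (Var ''agents'')"
  let ?c2 = "Call ''tour'' P (MkPair (Var ''graph'') (Var ''jobs'')) ;; ?c3"
  let ?move = "While (Var ''own'') (
       ''jobs'' ::= MkPair (Head (Var ''own'')) (Var ''jobs'') ;; ''own'' ::= Tail (Var ''own''))"
  let ?c1 = "''own'' ::= Tail (Head (Var ''entry'')) ;; ?move ;; ?c2"
  have c3: "halts_within M ?c3 s' 9 ?Q"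
    if "s' ''graph'' = g" "s' ''agents'' = s ''agents''" "s' ''table'' = s ''table''"
      "s' ''done'' = s ''done''" "s' ''tour'' = r" for s'
    using that s
    by (intro halts_within_mono[OF halts_within_Assign_Seq[OF halts_within_Assign_Seq[OF
          halts_within_Assign[where Q = ?Q]]]]) auto
  \<comment> \<open>The tour algorithm runs in a fresh store, so whatever it does, only
    \<open>tour\<close> changes here.\<close>
  have c2: "halts_within M ?c2 s' (D + 13) ?Q"
    if "s' ''graph'' = g" "s' ''agents'' = s ''agents''" "s' ''table'' = s ''table''"
      "s' ''done'' = s ''done''" "s' ''jobs'' = val_of_list (rev (L i) @ js)" for s'
    by (rule halts_within_mono[OF halts_within_Seq[OF
          halts_within_Call[where t = t and r = r and Q = "\<lambda>s'. halts_within M ?c3 s' 9 ?Q"]]])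
      (use that run c3 in auto)
  have c1: "halts_within M ?c1 (s(''entry'' := Pair (Pair (val_of_nat i) (val_of_list (L i))) rest))
      (4 + (2 + 10 * N + (D + 13))) ?Q" for rest
    by (rule halts_within_mono[OF halts_within_Assign_Seq[OF halts_within_Seq[OF
          halts_within_mono[OF move_list_loop[where us = "L i" and vs = js]
            order_refl, where Q' = "\<lambda>s'. halts_within M ?c2 s' (D + 13) ?Q"]]]])
      (simp_all add: s(1-3) N c2)
  let ?s = "s(''entry'' := s ''table'')"
  have "halts_within M
      (While (IsNull (Equal (Head (Head (Var ''entry''))) (Head (Var ''agents''))))
       (''entry'' ::= Tail (Var ''entry''))) ?s (length ids * (10 + 2 * N))
      (\<lambda>s'. halts_within M ?c1 s' (4 + (2 + 10 * N + (D + 13))) ?Q)"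
    by (rule halts_within_mono[OF find_entry_loop[where c = "\<lambda>i. val_of_list (L i)" and i = i
          and N = N and ids = ids and as = as]]) (use s i c1 in auto)
  moreover have "length ids * (10 + 2 * N) \<le> N * (10 + 2 * N)" using N by simp
  ultimately show ?thesis
    by (intro halts_within_mono[OF halts_within_Assign_Seq[OF halts_within_Seq[where
          T = "length ids * (10 + 2 * N)"]]]) (auto simp: algebra_simps)
qed

text \<open>Invariant before agent \<open>j\<close>: \<open>done\<close> holds the tours of the
  earlier agents, latest first, and \<open>n\<close> agents remain. Each round adds 2 for the loop
  test to the 30 of \<open>agent_step_halts\<close>.\<close>

lemma agents_loop:
  fixes f :: "nat \<Rightarrow> nat"
  assumes i: "\<And>j. j \<in> {1..k} \<Longrightarrow> f j \<in> set ids"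
      "\<And>i. i \<in> set ids \<Longrightarrow> number_size M (real i) \<le> N"
    and N: "length ids \<le> N" "\<And>i. i \<in> set ids \<Longrightarrow> length (L i) \<le> N"
    and run: "\<And>j. j \<in> {1..k} \<Longrightarrow> \<exists>t\<le>D.
      runs M P (Pair g (val_of_list (rev (L (f j)) @ (if j = 1 then L 0 else [])))) t (r j)"
    and s: "s ''graph'' = g" "s ''jobs'' = val_of_list (if j = 1 then L 0 else [])"
      "s ''agents'' = val_of_nats (map f [j..<Suc k])"
      "s ''table'' = val_of_list (map (\<lambda>i. Pair (val_of_nat i) (val_of_list (L i))) ids)"
      "s ''done'' = val_of_list (rev (map r [1..<j]))"
    and j: "1 \<le> j" "j + n = Suc k"
  shows "halts_within M (While (Var ''agents'') (agent_step P)) s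
    (2 + n * (N * (20 + 2 * N) + D + 32)) (\<lambda>s'. s' ''done'' = val_of_list (rev (map r [1..<Suc k])))"
    (is "halts_within M _ s _ ?Q")
  using s j
proof (induction n arbitrary: s j)
  case 0
  then show ?case
    by (intro halts_within_mono[OF halts_within_While_done[where Q = ?Q]]) (auto simp: val_of_nats_def)
next
  case (Suc n)
  then have jk: "j \<in> {1..k}" by auto
  let ?B = "N * (20 + 2 * N) + D + 30"
  let ?T = "2 + n * (N * (20 + 2 * N) + D + 32)"
  let ?as = "val_of_nats (map f [Suc j..<Suc k])"
  have agents: "s ''agents'' = Pair (val_of_nat (f j)) ?as"
    using Suc.prems(3) jk by (simp add: val_of_nats_def upt_conv_Cons del: upt_Suc)
  obtain t where t: "t \<le> D"
    "runs M P (Pair g (val_of_list (rev (L (f j)) @ (if j = 1 then L 0 else [])))) t (r j)"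
    using run[OF jk] by blast
  have "halts_within M (agent_step P) s ?B
      (\<lambda>s'. halts_within M (While (Var ''agents'') (agent_step P)) s' ?T ?Q)"
  proof (rule halts_within_mono[OF agent_step_halts[OF Suc.prems(1,2) agents Suc.prems(4) i(1)[OF jk]
        i(2) N(1) N(2)[OF i(1)[OF jk]] t(2,1)] order_refl], assumption)
    fix s'
    assume "s' ''graph'' = g \<and> s' ''jobs'' = Null \<and> s' ''agents'' = ?as \<and>
          s' ''table'' = s ''table'' \<and> s' ''done'' = Pair (r j) (s ''done'')"
    then show "halts_within M (While (Var ''agents'') (agent_step P)) s' ?T ?Q"
      \<comment> \<open>From \<open>1 \<le> j\<close> it follows that \<open>Suc j\<close> is not 1,
        so the invariant asks for empty \<open>jobs\<close>, as the body left it.\<close>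
      using Suc.prems by (intro Suc.IH[of s' "Suc j"]) (auto simp del: upt_Suc simp: upt_Suc_append)
  qed
  then show ?case
    by (intro halts_within_mono[OF halts_within_While_step]) (auto simp: agents algebra_simps)
qed

text \<open>The final reversal costs 10 per tour, raising 32 to 42; the 30 covers the initial
  assignments and the two final loop tests.\<close>

lemma naive_allocation_runs:
  fixes f :: "nat \<Rightarrow> nat"
  assumes i: "\<And>j. j \<in> {1..k} \<Longrightarrow> f j \<in> set ids"
      "\<And>i. i \<in> set ids \<Longrightarrow> number_size M (real i) \<le> N"
    and N: "length ids \<le> N" "\<And>i. i \<in> set ids \<Longrightarrow> length (L i) \<le> N" "k \<le> N"
    and run: "\<And>j. j \<in> {1..k} \<Longrightarrow> \<exists>t\<le>D.
      runs M P (Pair g (val_of_list (rev (L (f j)) @ (if j = 1 then L 0 else [])))) t (r j)"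
    and v: "v = Pair g (Pair (val_of_list (L 0)) (Pair (val_of_nats (map f [1..<Suc k]))
      (val_of_list (map (\<lambda>i. Pair (val_of_nat i) (val_of_list (L i))) ids))))"
  shows "\<exists>t \<le> N * (N * (20 + 2 * N) + D + 42) + 30.
    runs M (naive_allocation P) v t (val_of_list (map r [1..<Suc k]))"
proof -
  let ?loop = "While (Var ''agents'') (agent_step P)"
  let ?move = "While (Var ''done'') (
       ''out'' ::= MkPair (Head (Var ''done'')) (Var ''out'') ;; ''done'' ::= Tail (Var ''done''))"
  let ?c = "''out'' ::= Empty ;; ?move"
  let ?Q = "\<lambda>s'. s' ''out'' = val_of_list (map r [1..<Suc k])"
  define s where "s = (init_store v)(''graph'' := g, ''jobs'' := val_of_list (L 0),
    ''agents'' := val_of_nats (map f [1..<Suc k]),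
    ''table'' := val_of_list (map (\<lambda>i. Pair (val_of_nat i) (val_of_list (L i))) ids),
    ''done'' := Null)"
  have c: "halts_within M ?c s' (2 + (2 + 10 * k)) ?Q"
    if "s' ''done'' = val_of_list (rev (map r [1..<Suc k]))" for s'
    by (rule halts_within_mono[OF halts_within_Assign_Seq[OF
          move_list_loop[where us = "rev (map r [1..<Suc k])" and vs = "[]"]]])
      (use that in \<open>auto simp del: upt_Suc\<close>)
  have "halts_within M ?loop s (2 + k * (N * (20 + 2 * N) + D + 32))
      (\<lambda>s'. halts_within M ?c s' (2 + (2 + 10 * k)) ?Q)"
    by (rule halts_within_mono[OF agents_loop[OF i N(1,2) run, where j = 1 and n = k]])
      (use c in \<open>auto simp: s_def simp del: upt_Suc\<close>)
  from halts_within_Seq[OF this]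
  have main: "halts_within M (?loop ;; ?c) s
      (2 + k * (N * (20 + 2 * N) + D + 32) + (2 + (2 + 10 * k))) ?Q" .
  have "halts_within M (naive_allocation P) (init_store v)
      (2 + k * (N * (20 + 2 * N) + D + 32) + (2 + (2 + 10 * k)) + 20) ?Q"
    unfolding naive_allocation_def
    by (intro halts_within_mono[OF halts_within_Assign_Seq[OF halts_within_Assign_Seq[OF
          halts_within_Assign_Seq[OF halts_within_Assign_Seq[OF halts_within_Assign_Seq[where
          T = "2 + k * (N * (20 + 2 * N) + D + 32) + (2 + (2 + 10 * k))" and Q = ?Q]]]]]])
      (use main in \<open>auto simp: s_def v init_store_def simp del: upt_Suc\<close>)
  moreover have "k * (N * (20 + 2 * N) + D + 42) \<le> N * (N * (20 + 2 * N) + D + 42)"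
    using N(3) by simp
  ultimately have "halts_within M (naive_allocation P) (init_store v)
      (N * (N * (20 + 2 * N) + D + 42) + 30) ?Q"
    by (elim halts_within_mono) (auto simp: algebra_simps)
  then show ?thesis unfolding halts_within_def runs_def by blast
qed

section \<open>The approximation guarantee\<close>

abbreviation tour_input :: "cost_model \<Rightarrow> val \<Rightarrow> bool" where
  "tour_input M v \<equiv> \<exists>G V'. metric_network G \<and> admissible_network M G \<and> V' \<subseteq> verts G \<and>
     encodes_tour_input v G V'"

abbreviation tour_output :: "cost_model \<Rightarrow> real \<Rightarrow> val \<Rightarrow> val \<Rightarrow> bool" where
  "tour_output M \<alpha> v r \<equiv> \<forall>G V'. metric_network G \<and> admissible_network M G \<and> V' \<subseteq> verts G \<and>
     encodes_tour_input v G V' \<longrightarrow>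
     (\<exists>w. r = val_of_nats w \<and> is_tour G V' w \<and> walk_cost G w \<le> \<alpha> * opt_tour_cost G V')"

abbreviation htap_input :: "cost_model \<Rightarrow> val \<Rightarrow> htap \<Rightarrow> bool" where
  "htap_input M v I \<equiv> htap_instance I \<and> admissible_network M (htap_network I) \<and> encodes_htap v I"

abbreviation htap_output :: "real \<Rightarrow> htap \<Rightarrow> val \<Rightarrow> bool" where
  "htap_output \<rho> I r \<equiv> \<exists>S w. r = val_of_tours (num_agents I) w \<and> feasible_solution I S w \<and>
     solution_value I w \<le> \<rho> * htap_opt I"

lemma naive_allocation_solves:
  assumes p: "\<forall>v\<in>Collect (tour_input M).
      \<exists>t r. runs M P v t r \<and> t \<le> poly p (val_size M v) \<and> tour_output M \<alpha> v r"
    and "\<alpha> \<ge> 0" and I': "htap_input M v I" and N: "N = val_size M v"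
  shows "\<exists>t r. runs M (naive_allocation P) v t r \<and>
    t \<le> N * (N * (20 + 2 * N) + poly p (1 + 3 * N) + 42) + 30 \<and>
    htap_output (\<alpha> * real (num_agents I)) I r"
proof -
  have I: "htap_instance I" "admissible_network M (htap_network I)" "encodes_htap v I"
    using I' by auto
  let ?G = "htap_network I" and ?k = "num_agents I" and ?m = "num_types I" and ?f = "type_of I"
  have G: "metric_network ?G" using I(1) by (simp add: htap_instance_def)
  obtain g c where g: "encodes_network g ?G" and c: "\<And>i. i \<in> {0..?m} \<Longrightarrow> encodes_set (c i) (tasks I i)"
    and v: "v = Pair g (Pair (c 0) (Pair (val_of_nats (map ?f [1..<Suc ?k]))
                 (val_of_list (map (\<lambda>i. Pair (val_of_nat i) (c i)) [1..<Suc ?m]))))"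
    using I(3) unfolding encodes_htap_def by blast
  from c obtain xs where xs: "\<And>i. i \<in> {0..?m} \<Longrightarrow>
      distinct (xs i) \<and> set (xs i) = tasks I i \<and> c i = val_of_nats (xs i)"
    unfolding encodes_set_def by metis
  define L where "L = (\<lambda>i. map val_of_nat (xs i))"
  have cL: "c i = val_of_list (L i)" if "i \<in> {0..?m}" for i
    using xs[OF that] by (simp add: L_def val_of_nats_def)
  have vL: "v = Pair g (Pair (val_of_list (L 0)) (Pair (val_of_nats (map ?f [1..<Suc ?k]))
                 (val_of_list (map (\<lambda>i. Pair (val_of_nat i) (val_of_list (L i))) [1..<Suc ?m]))))"
    unfolding v using cL by (auto simp del: upt_Suc intro!: arg_cong[where f = val_of_list])
  let ?table = "val_of_list (map (\<lambda>i. Pair (val_of_nat i) (val_of_list (L i))) [1..<Suc ?m])"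
  have sizes: "val_size M g \<le> N" "val_size M (val_of_list (L 0)) \<le> N" "?k \<le> N"
    "val_size M ?table \<le> N" "?m \<le> N"
    using length_le_val_size[of "map val_of_nat (map ?f [1..<Suc ?k])" M]
      length_le_val_size[of "map (\<lambda>i. Pair (val_of_nat i) (val_of_list (L i))) [1..<Suc ?m]" M]
    unfolding N vL val_of_nats_def by (simp_all del: upt_Suc)
  have entry: "number_size M (real i) \<le> N" "val_size M (val_of_list (L i)) \<le> N"
    if "i \<in> {1..?m}" for i
  proof -
    have "val_size M (Pair (val_of_nat i) (val_of_list (L i))) \<le> val_size M ?table"
      using that by (intro val_size_member) (auto simp del: upt_Suc)
    with sizes show "number_size M (real i) \<le> N" "val_size M (val_of_list (L i)) \<le> N"
      by (auto simp: val_of_nat_def)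
  qed
  define inp where "inp = (\<lambda>j. Pair g (val_of_list (rev (L (?f j)) @ (if j = 1 then L 0 else []))))"
  have inp: "encodes_tour_input (inp j) ?G (naive_set I j)" if j: "j \<in> {1..?k}" for j
  proof -
    have f: "?f j \<in> {1..?m}" using type_of_bounds[OF I(1) j] .
    \<comment> \<open>Types of agents start at 1, so index 0 is a different class; hence the
      concatenated list has no repetitions.\<close>
    then have "tasks I (?f j) \<inter> tasks I 0 = {}" using I(1) by (auto simp: htap_instance_def)
    then have "distinct (rev (xs (?f j)) @ (if j = 1 then xs 0 else []))"
      "set (rev (xs (?f j)) @ (if j = 1 then xs 0 else [])) = naive_set I j"
      using xs[of 0] xs[of "?f j"] f by (auto simp: naive_set_def)
    moreover have "val_of_list (rev (L (?f j)) @ (if j = 1 then L 0 else [])) =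
        val_of_nats (rev (xs (?f j)) @ (if j = 1 then xs 0 else []))"
      by (simp add: L_def val_of_nats_def rev_map)
    ultimately have "encodes_set (val_of_list (rev (L (?f j)) @ (if j = 1 then L 0 else [])))
        (naive_set I j)" unfolding encodes_set_def by blast
    with g show ?thesis unfolding encodes_tour_input_def inp_def by blast
  qed
  \<comment> \<open>One pair node plus graph, own tasks and generic tasks, each of size at most
    \<open>N\<close>. For \<open>j \<noteq> 1\<close> the third part is the empty list of size 1,
    whence \<open>N \<ge> 1\<close>.\<close>
  have size: "val_size M (inp j) \<le> 1 + 3 * N" if "j \<in> {1..?k}" for j
  proof -
    have "val_size M (val_of_list (rev (L (?f j)) @ (if j = 1 then L 0 else []))) \<le>
        val_size M (val_of_list (L (?f j))) + val_size M (val_of_list (if j = 1 then L 0 else []))"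
      using val_size_append[of M "rev (L (?f j))"] by (simp add: val_size_rev)
    moreover have "N \<ge> 1" using val_size_pos N by simp
    ultimately show ?thesis
      using entry(2)[OF type_of_bounds[OF I(1) that]] sizes by (auto simp: inp_def split: if_splits)
  qed
  have "\<exists>w. is_tour ?G (naive_set I j) w \<and>
      walk_cost ?G w \<le> \<alpha> * opt_tour_cost ?G (naive_set I j) \<and>
      (\<exists>t\<le>poly p (1 + 3 * N). runs M P (inp j) t (val_of_nats w))" if j: "j \<in> {1..?k}" for j
  proof -
    have sub: "naive_set I j \<subseteq> verts ?G"
      using naive_set_subset[OF I(1) j] by (auto simp: htap_network_def)
    have "inp j \<in> Collect (tour_input M)" using G I(2) sub inp[OF j] by blast
    from bspec[OF p this] obtain t r where tr: "runs M P (inp j) t r"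
      "t \<le> poly p (val_size M (inp j))" and out: "tour_output M \<alpha> (inp j) r" by (elim exE conjE)
    have good: "\<exists>w. r = val_of_nats w \<and> is_tour ?G (naive_set I j) w \<and>
        walk_cost ?G w \<le> \<alpha> * opt_tour_cost ?G (naive_set I j)"
      using out[rule_format, of ?G "naive_set I j"] G I(2) sub inp[OF j] by simp
    have "t \<le> poly p (1 + 3 * N)" using tr(2) poly_nat_mono[OF size[OF j]] by (rule order_trans)
    with tr(1) good show ?thesis by blast
  qed
  then obtain w where w: "\<And>j. j \<in> {1..?k} \<Longrightarrow> is_tour ?G (naive_set I j) (w j) \<and>
      walk_cost ?G (w j) \<le> \<alpha> * opt_tour_cost ?G (naive_set I j) \<and>
      (\<exists>t\<le>poly p (1 + 3 * N). runs M P (inp j) t (val_of_nats (w j)))" by metis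
  have "\<exists>t \<le> N * (N * (20 + 2 * N) + poly p (1 + 3 * N) + 42) + 30.
    runs M (naive_allocation P) v t (val_of_list (map (\<lambda>j. val_of_nats (w j)) [1..<Suc ?k]))"
  proof (rule naive_allocation_runs[OF _ _ _ _ sizes(3) _ vL])
    show "?f j \<in> set [1..<Suc ?m]" if "j \<in> {1..?k}" for j
      using type_of_bounds[OF I(1) that] by auto
    show "number_size M (real i) \<le> N" if "i \<in> set [1..<Suc ?m]" for i
      using entry(1) that by auto
    show "length [1..<Suc ?m] \<le> N" using sizes(5) by simp
    show "length (L i) \<le> N" if "i \<in> set [1..<Suc ?m]" for i
      using entry(2)[of i] length_le_val_size[of "L i" M] that by auto
    show "\<exists>t\<le>poly p (1 + 3 * N). runs M P
        (Pair g (val_of_list (rev (L (?f j)) @ (if j = 1 then L 0 else [])))) t (val_of_nats (w j))"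
      if "j \<in> {1..?k}" for j
      using w[OF that] unfolding inp_def by blast
  qed
  moreover have "feasible_solution I (naive_set I) w"
    using feasible_naive_set[OF I(1)] w by (auto simp: feasible_solution_def)
  moreover have "solution_value I w \<le> \<alpha> * real ?k * htap_opt I"
    using w by (intro naive_solution_value[OF I(1) \<open>\<alpha> \<ge> 0\<close>]) auto
  ultimately show ?thesis unfolding val_of_tours_def by blast
qed

theorem theorem1:
  fixes M :: cost_model and \<alpha> :: real and tour_alg :: com
  assumes "tour_approximation M \<alpha> tour_alg"
  shows "htap_approximation M (\<lambda>I. \<alpha> * real (num_agents I)) (naive_allocation tour_alg)"
proof -
  obtain p :: "nat poly" where p: "\<forall>v\<in>Collect (tour_input M).
      \<exists>t r. runs M tour_alg v t r \<and> t \<le> poly p (val_size M v) \<and> tour_output M \<alpha> v r"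
    using assms unfolding tour_approximation_def solves_in_poly_time_def by (rule exE)
  \<comment> \<open>The time bound of \<open>naive_allocation_solves\<close> as a polynomial in
    \<open>N\<close>; \<open>pcompose p [:1, 3:]\<close> stands for the cost of one call on an input
    of size at most 1 + 3 \<open>N\<close>.\<close>
  define q :: "nat poly" where
    "q = [:0, 1:] * ([:0, 1:] * [:20, 2:] + pcompose p [:1, 3:] + [:42:]) + [:30:]"
  have q: "poly q N = N * (N * (20 + 2 * N) + poly p (1 + 3 * N) + 42) + 30" for N
    by (simp add: q_def poly_pcompose mult.commute)
  have solves: "\<exists>t r. runs M (naive_allocation tour_alg) v t r \<and> t \<le> poly q (val_size M v) \<and>
      htap_output (\<alpha> * real (num_agents I)) I r" if "htap_input M v I" for v I
    unfolding q by (rule naive_allocation_solves[OF p tour_approximation_nonneg[OF assms] that refl])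
  show ?thesis unfolding htap_approximation_def solves_in_poly_time_def
  proof (intro exI[of _ q] ballI)
    fix v assume "v \<in> {v. \<exists>I. htap_input M v I}"
    then obtain I where "htap_input M v I" by blast
    from solves[OF this] obtain t r where
      tr: "runs M (naive_allocation tour_alg) v t r" "t \<le> poly q (val_size M v)" by (elim exE conjE)
    \<comment> \<open>\<open>v\<close> may encode several instances; by determinism they share the output \<open>r\<close>.\<close>
    have out: "htap_output (\<alpha> * real (num_agents J)) J r" if J: "htap_input M v J" for J
    proof -
      from solves[OF J] obtain t' r' where "runs M (naive_allocation tour_alg) v t' r'"
        and out: "htap_output (\<alpha> * real (num_agents J)) J r'" by blast
      then have "r' = r" using runs_deterministic[OF tr(1)] by blast
      with out show ?thesis by (simp only:)
    qed
    show "\<exists>t r. runs M (naive_allocation tour_alg) v t r \<and> t \<le> poly q (val_size M v) \<and>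
        (\<forall>I. htap_input M v I \<longrightarrow> htap_output (\<alpha> * real (num_agents I)) I r)"
      by (intro exI[of _ t] exI[of _ r] conjI tr allI impI) (rule out)
  qed
qed

end
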